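(* Let $\mathcal{H}$ be a complex Hilbert space and let $T$ be a (not necessarily powerbounded) bounded linear operator on $\mathcal{H}$ for which the Cesàro asymptotic limit $A_{T,C}$ exists and is not zero. Then $$\|A_{T,C}\|\ge 1.$$
   Context: $\mathcal{H}$ is not necessarily finite dimensional. For a bounded linear operator $T$ on $\mathcal{H}$, a bounded linear operator $A_{T,C}$ on $\mathcal{H}$ is called the Cesàro asymptotic limit of $T$ if $\frac1n\sum_{j=1}^n T^{*j}T^j\to A_{T,C}$ as $n\to\infty$ in the weak operator topology. $\|\cdot\|$ is the operator norm. $T$ is powerbounded if there is $M>0$ such that $\|T^n\|<M$ for all $n\in\mathbb{N}$. *)

theory Defs
  imports "HOL-Analysis.Analysis"
begin

section \<open>Complex Hilbert spaces\<close>

text \<open>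
  HOL-Analysis only has real inner product spaces. The superclass \<^class>\<open>real_normed_vector\<close>
  supplies the norm, metric and topology; the real scaling and the norm it comes with are tied to
  the complex structure by \<open>scaleR_scaleC\<close> and \<open>norm_eq_sqrt_cinner\<close>.
\<close>

class complex_vector = real_vector +
  fixes scaleC :: "complex \<Rightarrow> 'a \<Rightarrow> 'a"  (infixr "*\<^sub>C" 75)
  assumes scaleC_add_right: "c *\<^sub>C (x + y) = c *\<^sub>C x + c *\<^sub>C y"
    and scaleC_add_left: "(c + d) *\<^sub>C x = c *\<^sub>C x + d *\<^sub>C x"
    and scaleC_scaleC: "c *\<^sub>C d *\<^sub>C x = (c * d) *\<^sub>C x"
    and scaleR_scaleC: "r *\<^sub>R x = complex_of_real r *\<^sub>C x"

text \<open>The inner product is linear in its first and conjugate-linear in its second argument.\<close>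

class complex_inner = complex_vector + real_normed_vector +
  fixes cinner :: "'a \<Rightarrow> 'a \<Rightarrow> complex"
  assumes cinner_commute: "cinner x y = cnj (cinner y x)"
    and cinner_add_left: "cinner (x + y) z = cinner x z + cinner y z"
    and cinner_scaleC_left: "cinner (c *\<^sub>C x) y = c * cinner x y"
    and cinner_ge_zero: "0 \<le> Re (cinner x x)"
    and cinner_eq_zero_iff: "cinner x x = 0 \<longleftrightarrow> x = 0"
    and norm_eq_sqrt_cinner: "norm x = sqrt (Re (cinner x x))"

class chilbert_space = complex_inner + complete_space

instantiation complex :: chilbert_space
begin

definition scaleC_complex :: "complex \<Rightarrow> complex \<Rightarrow> complex" where
  "scaleC_complex c x = c * x"

definition cinner_complex :: "complex \<Rightarrow> complex \<Rightarrow> complex" where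
  "cinner_complex x y = x * cnj y"

instance
  by standard
    (auto simp: scaleC_complex_def cinner_complex_def algebra_simps scaleR_conv_of_real
      cmod_def power2_eq_square)

end


section \<open>Bounded operators, adjoint and weak operator topology\<close>

definition bounded_clinear :: "('a::complex_inner \<Rightarrow> 'b::complex_inner) \<Rightarrow> bool" where
  "bounded_clinear T \<longleftrightarrow> bounded_linear T \<and> (\<forall>c x. T (c *\<^sub>C x) = c *\<^sub>C T x)"

text \<open>
  On a Hilbert space, the operator described here exists and is unique for every bounded
  operator \<open>T\<close>, by the Riesz representation theorem.
\<close>

definition cadjoint :: "('a::chilbert_space \<Rightarrow> 'a) \<Rightarrow> 'a \<Rightarrow> 'a" where
  "cadjoint T = (THE S. \<forall>x y. cinner (T x) y = cinner x (S y))"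

text \<open>
  The coarsest topology on the set of bounded operators making every functional
  \<open>\<lambda>S. cinner (S x) y\<close> continuous.
\<close>

definition weak_operator_topology :: "('a::chilbert_space \<Rightarrow> 'a) topology" where
  "weak_operator_topology =
     topology_generated_by {{S. bounded_clinear S \<and> cinner (S x) y \<in> U} | x y U. open U}"

lemma topspace_weak_operator_topology [simp]:
  "topspace weak_operator_topology = {S. bounded_clinear S}"
  unfolding weak_operator_topology_def topology_generated_by_topspace
  by (auto intro!: exI[of _ UNIV])


section \<open>Cesaro asymptotic limit\<close>

text \<open>The mean for \<open>n = 0\<close> is the zero operator, which is irrelevant for the limit.\<close>

definition cesaro_mean :: "('a::chilbert_space \<Rightarrow> 'a) \<Rightarrow> nat \<Rightarrow> 'a \<Rightarrow> 'a" where
  "cesaro_mean T n = (\<lambda>x. (1 / real n) *\<^sub>R (\<Sum>j=1..n. (cadjoint T ^^ j) ((T ^^ j) x)))"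

definition is_cesaro_asymptotic_limit ::
  "('a::chilbert_space \<Rightarrow> 'a) \<Rightarrow> ('a \<Rightarrow> 'a) \<Rightarrow> bool" where
  "is_cesaro_asymptotic_limit T A \<longleftrightarrow>
     limitin weak_operator_topology (cesaro_mean T) A sequentially"

end

theory Submission
  imports Defs
begin

text \<open>
  Write \<open>L x = \<langle>A x, x\<rangle>\<close>, the Cesaro limit of \<open>\<parallel>T\<^sup>j x\<parallel>\<^sup>2\<close>. A shift of the sequence does not change its
  Cesaro limit, so \<open>L (T x) = L x\<close>. Hence \<open>L x = L (T\<^sup>j x) \<le> \<parallel>A\<parallel> \<parallel>T\<^sup>j x\<parallel>\<^sup>2\<close> for every \<open>j\<close>, and averaging
  over \<open>j\<close> yields \<open>L x \<le> \<parallel>A\<parallel> L x\<close>. By polarization \<open>L x > 0\<close> for some \<open>x\<close> unless \<open>A = 0\<close>.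
\<close>

section \<open>Complex inner products\<close>

lemma cinner_add_right: "cinner x (y + z) = cinner x y + cinner x z"
  by (metis cinner_commute cinner_add_left complex_cnj_add)

lemma cinner_scaleC_right: "cinner x (c *\<^sub>C y) = cnj c * cinner x y"
  by (metis cinner_commute cinner_scaleC_left complex_cnj_mult)

lemma cinner_scaleR_left: "cinner (r *\<^sub>R x) y = of_real r * cinner x y"
  by (simp add: scaleR_scaleC cinner_scaleC_left)

lemma cinner_zero_left [simp]: "cinner 0 y = 0"
  using cinner_scaleR_left[of 0 0 y] by simp

lemma cinner_minus_left: "cinner (- x) y = - cinner x y"
  using cinner_scaleR_left[of "-1" x y] by simp

lemma cinner_diff_left: "cinner (x - y) z = cinner x z - cinner y z"
  using cinner_add_left[of x "- y" z] by (simp add: cinner_minus_left)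

lemma cinner_sum_left: "cinner (sum f I) y = (\<Sum>i\<in>I. cinner (f i) y)"
  by (induction I rule: infinite_finite_induct) (simp_all add: cinner_add_left)

lemma cinner_ext:
  assumes "\<And>z. cinner z x = cinner z y"
  shows "x = y"
proof -
  have "cinner x z = cinner y z" for z
    by (metis assms cinner_commute)
  then have "cinner (x - y) (x - y) = 0"
    by (simp add: cinner_diff_left)
  then show ?thesis
    using cinner_eq_zero_iff[of "x - y"] by simp
qed

lemma Re_cinner_self: "Re (cinner x x) = (norm x)\<^sup>2"
  by (simp add: norm_eq_sqrt_cinner cinner_ge_zero)

lemma cinner_self: "cinner x x = of_real ((norm x)\<^sup>2)"
proof -
  have "Im (cinner x x) = 0"
    using arg_cong[OF cinner_commute[of x x], of Im] by simp
  then show ?thesis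
    by (simp add: complex_eq_iff Re_cinner_self)
qed

lemma Re_cinner_commute: "Re (cinner x y) = Re (cinner y x)"
  using arg_cong[OF cinner_commute[of x y], of Re] by simp

lemma norm_add_sq: "(norm (x + y))\<^sup>2 = (norm x)\<^sup>2 + (norm y)\<^sup>2 + 2 * Re (cinner x y)"
  for x y :: "'a::complex_inner"
  by (simp add: Re_cinner_self[symmetric] cinner_add_left cinner_add_right Re_cinner_commute[of y x])

lemma parallelogram_law:
  "(norm (x + y))\<^sup>2 + (norm (x - y))\<^sup>2 = 2 * (norm x)\<^sup>2 + 2 * (norm y)\<^sup>2"
  for x y :: "'a::complex_inner"
proof -
  have "cinner x (- y) = - cinner x y"
    by (metis cinner_commute cinner_minus_left complex_cnj_minus)
  then show ?thesis
    using norm_add_sq[of x y] norm_add_sq[of x "- y"] by simp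
qed

text \<open>The real part of the Cauchy-Schwarz inequality follows from the triangle inequality,
  which comes with \<open>real_normed_vector\<close>, by squaring and expanding both sides.\<close>

lemma Re_cinner_le: "Re (cinner x y) \<le> norm x * norm y"
proof -
  have "(norm (x + y))\<^sup>2 \<le> (norm x + norm y)\<^sup>2"
    by (simp add: norm_triangle_ineq power_mono)
  then show ?thesis
    by (simp add: norm_add_sq power2_sum)
qed

text \<open>Polarization over the complex scalars: expanding the quadratic form at
  \<open>u + v\<close> gives a symmetric relation, and testing it with both \<open>T x\<close> and
  \<open>\<i> *\<^sub>C T x\<close> isolates \<open>cinner (T x) (T x)\<close>.\<close>

lemma bounded_clinear_eq_zeroI:
  assumes T: "bounded_clinear T" and zero: "\<And>x. cinner (T x) x = 0"
  shows "T = (\<lambda>x. 0)"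
proof
  fix x
  have add: "T (u + v) = T u + T v" for u v
    using T by (simp add: bounded_clinear_def linear_simps)
  have scale: "T (c *\<^sub>C u) = c *\<^sub>C T u" for c u
    using T by (simp add: bounded_clinear_def)
  have *: "cinner (T u) v + cinner (T v) u = 0" for u v
    using zero[of "u + v"] by (simp add: add cinner_add_left cinner_add_right zero add.commute)
  \<comment> \<open>The second argument is conjugate-linear, so the two terms pick up opposite
    factors and must be equal. Their sum also vanishes, by \<open>*\<close> with
    \<open>v = T x\<close>, hence each is zero.\<close>
  have "- \<i> * cinner (T x) (T x) + \<i> * cinner (T (T x)) x = 0"
    using *[of x "\<i> *\<^sub>C T x"] by (simp add: scale cinner_scaleC_left cinner_scaleC_right)
  then have "cinner (T (T x)) x = cinner (T x) (T x)"
    by simp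
  with *[of x "T x"] have "cinner (T x) (T x) = 0"
    by simp
  then show "T x = 0"
    using cinner_eq_zero_iff by blast
qed

section \<open>Riesz representation and adjoints\<close>

lemma quadratic_nonneg_linear_coeff_zero:
  fixes a b :: real
  assumes "\<And>t. 0 \<le> t\<^sup>2 * a + t * b"
  shows "b = 0"
proof -
  \<comment> \<open>With \<open>s\<close> positive and larger than \<open>a\<close>, the value of
    the quadratic at \<open>t = - b / s\<close> is negative unless \<open>b = 0\<close>.\<close>
  define s where "s = \<bar>a\<bar> + 1"
  have s: "s > 0" "a < s"
    by (auto simp: s_def)
  have "0 \<le> (- b / s)\<^sup>2 * a + (- b / s) * b"
    by (rule assms)
  also have "\<dots> = b\<^sup>2 * (a - s) / s\<^sup>2"
    using s by (simp add: field_simps power2_eq_square)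
  finally have "0 \<le> b\<^sup>2 * (a - s)"
    using s by (simp add: zero_le_divide_iff)
  then show ?thesis
    using s by (simp add: zero_le_mult_iff)
qed

text \<open>The representing vector minimizes \<open>\<parallel>x\<parallel>\<^sup>2 - 2 f x\<close>.\<close>

lemma real_riesz_representation:
  fixes f :: "'a::chilbert_space \<Rightarrow> real"
  assumes f: "bounded_linear f"
  shows "\<exists>y. \<forall>x. f x = Re (cinner x y)"
proof -
  interpret f: bounded_linear f by (rule f)
  define J where "J x = (norm x)\<^sup>2 - 2 * f x" for x
  define m where "m = Inf (range J)"
  obtain K where K: "\<And>x. \<bar>f x\<bar> \<le> norm x * K"
    using f.bounded by auto
  \<comment> \<open>Completing the square: \<open>J x\<close> is at least
    \<open>(norm x - K)\<^sup>2 - K\<^sup>2\<close>.\<close>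
  have "- K\<^sup>2 \<le> J x" for x
  proof -
    have "0 \<le> (norm x - K)\<^sup>2" by simp
    with K[of x] show ?thesis
      by (simp add: J_def power2_diff)
  qed
  then have bdd: "bdd_below (range J)"
    by (auto intro!: bdd_belowI)
  have m_le: "m \<le> J x" for x
    unfolding m_def using bdd by (intro cInf_lower) auto
  have "\<exists>x. J x < m + 1 / real (Suc n)" for n
    using cInf_less_iff[of "range J" "m + 1 / real (Suc n)"] bdd
    by (auto simp: m_def)
  then obtain X where X: "\<And>n. J (X n) < m + 1 / real (Suc n)"
    by metis
  \<comment> \<open>The midpoint of \<open>x\<close> and \<open>y\<close> also has \<open>J\<close>
    at least \<open>m\<close>, and the parallelogram law turns this into a distance bound.
    Minimizing sequences are therefore Cauchy.\<close>
  have dist_sq: "(norm (x - y))\<^sup>2 \<le> 2 * (J x - m) + 2 * (J y - m)" for x y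
  proof -
    have "4 * m \<le> 4 * J ((1/2) *\<^sub>R (x + y))"
      using m_le by simp
    also have "\<dots> = (norm (x + y))\<^sup>2 - 4 * (f x + f y)"
      by (simp only: J_def f.scaleR f.add norm_scaleR) (simp add: power_divide field_simps)
    finally show ?thesis
      using parallelogram_law[of x y] by (simp add: J_def)
  qed
  have "Cauchy X"
  proof (rule metric_CauchyI)
    fix e :: real assume e: "e > 0"
    \<comment> \<open>In \<open>dist_sq\<close> the excess over \<open>m\<close> of each of the two
      points counts twice, so \<open>e\<^sup>2 / 4\<close> for each adds up to
      \<open>e\<^sup>2\<close>.\<close>
    obtain N where N: "1 / real (Suc N) < e\<^sup>2 / 4"
      using nat_approx_posE[of "e\<^sup>2 / 4"] e by auto
    have J_near: "J (X k) - m < e\<^sup>2 / 4" if "k \<ge> N" for k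
    proof -
      have "J (X k) - m < 1 / real (Suc k)"
        using X[of k] by (simp only: diff_less_eq add.commute)
      also have "\<dots> \<le> 1 / real (Suc N)"
        using that by (simp add: field_simps)
      finally show ?thesis
        using N by (rule less_trans)
    qed
    have "dist (X i) (X j) < e" if "i \<ge> N" "j \<ge> N" for i j
    proof -
      have "(norm (X i - X j))\<^sup>2 < e\<^sup>2"
        using dist_sq[of "X i" "X j"] J_near[OF that(1)] J_near[OF that(2)] by argo
      then show ?thesis
        using e by (simp add: dist_norm power_less_imp_less_base)
    qed
    then show "\<exists>M. \<forall>i\<ge>M. \<forall>j\<ge>M. dist (X i) (X j) < e"
      by blast
  qed
  then have "convergent X"
    by (rule Cauchy_convergent)
  then obtain y where y: "X \<longlonglongrightarrow> y"
    unfolding convergent_def by (rule exE)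
  have "(\<lambda>n. J (X n)) \<longlonglongrightarrow> J y"
    unfolding J_def by (intro tendsto_intros f.tendsto y)
  moreover have "(\<lambda>n. m + 1 / real (Suc n)) \<longlonglongrightarrow> m + 0"
    by (intro tendsto_intros LIMSEQ_Suc[OF lim_1_over_n])
  ultimately have "J y \<le> m + 0"
    by (rule LIMSEQ_le) (use X in \<open>blast intro: less_imp_le\<close>)
  then have J_min: "J y \<le> J x" for x
    using m_le[of x] by simp
  have "f x = Re (cinner x y)" for x
  proof -
    \<comment> \<open>First variation of \<open>J\<close> at its minimizer \<open>y\<close> in
      direction \<open>x\<close>: the coefficient of \<open>t\<close> has to vanish.\<close>
    have "0 \<le> t\<^sup>2 * (norm x)\<^sup>2 + t * (2 * (Re (cinner x y) - f x))" for t
    proof -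
      have "J (t *\<^sub>R x + y) = J y + t\<^sup>2 * (norm x)\<^sup>2 + t * (2 * (Re (cinner x y) - f x))"
        by (simp only: J_def norm_add_sq f.add f.scaleR cinner_scaleR_left)
          (simp add: power_mult_distrib algebra_simps)
      with J_min[of "t *\<^sub>R x + y"] show ?thesis by linarith
    qed
    then have "2 * (Re (cinner x y) - f x) = 0"
      by (rule quadratic_nonneg_linear_coeff_zero)
    then show ?thesis by simp
  qed
  then show ?thesis by blast
qed

text \<open>For fixed \<open>y\<close>, the real Riesz theorem represents the real part of
  \<open>cinner (T x) y\<close>; complex linearity then extends the identity to the imaginary
  part.\<close>

lemma cadjoint_exists:
  fixes T :: "'a::chilbert_space \<Rightarrow> 'a"
  assumes T: "bounded_clinear T"
  shows "\<exists>S. \<forall>x y. cinner (T x) y = cinner x (S y)"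
proof -
  interpret T: bounded_linear T
    using T by (simp add: bounded_clinear_def)
  have scale: "T (c *\<^sub>C u) = c *\<^sub>C T u" for c u
    using T by (simp add: bounded_clinear_def)
  have "\<exists>z. \<forall>x. cinner (T x) y = cinner x z" for y
  proof -
    obtain K where K: "\<And>x. norm (T x) \<le> norm x * K"
      using T.bounded by auto
    have "bounded_linear (\<lambda>x. Re (cinner (T x) y))"
    proof (rule bounded_linear_intro[where K = "K * norm y"])
      fix x
      have "Re (cinner (T x) y) \<le> norm (T x) * norm y"
        by (rule Re_cinner_le)
      moreover have "- Re (cinner (T x) y) \<le> norm (T x) * norm y"
        using Re_cinner_le[of "- T x" y] by (simp add: cinner_minus_left)
      moreover have "norm (T x) * norm y \<le> norm x * K * norm y"
        by (intro mult_right_mono K) simp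
      ultimately show "norm (Re (cinner (T x) y)) \<le> norm x * (K * norm y)"
        by (simp add: mult.assoc)
    qed (simp_all add: T.add T.scaleR cinner_add_left cinner_scaleR_left)
    then obtain z where z: "\<And>x. Re (cinner (T x) y) = Re (cinner x z)"
      using real_riesz_representation by blast
    \<comment> \<open>Multiplication by \<open>\<i>\<close> turns the real part into minus the
      imaginary part.\<close>
    have "Im (cinner (T x) y) = Im (cinner x z)" for x
      using z[of "\<i> *\<^sub>C x"] by (simp add: scale cinner_scaleC_left)
    with z show ?thesis
      by (auto simp: complex_eq_iff)
  qed
  then show ?thesis by metis
qed

text \<open>Justifies the definite description in \<open>cadjoint\<close>: existence is the Riesz
  argument, uniqueness is \<open>cinner_ext\<close>.\<close>

lemma cinner_cadjoint:
  assumes "bounded_clinear T"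
  shows "cinner (T x) y = cinner x (cadjoint T y)"
proof -
  obtain S where S: "\<forall>x y. cinner (T x) y = cinner x (S y)"
    using cadjoint_exists[OF assms] by blast
  have "\<forall>x y. cinner (T x) y = cinner x (cadjoint T y)"
    unfolding cadjoint_def
  proof (rule theI[where a = S])
    show "S' = S" if "\<forall>x y. cinner (T x) y = cinner x (S' y)" for S'
      by (rule ext, rule cinner_ext) (metis that S)
  qed (rule S)
  then show ?thesis by blast
qed

lemma cinner_funpow_cadjoint:
  assumes "bounded_clinear T"
  shows "cinner ((T ^^ j) x) y = cinner x ((cadjoint T ^^ j) y)"
proof (induction j arbitrary: y)
  case (Suc j)
  have "cinner ((T ^^ Suc j) x) y = cinner ((T ^^ j) x) (cadjoint T y)"
    by (simp add: cinner_cadjoint[OF assms])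
  also have "\<dots> = cinner x ((cadjoint T ^^ Suc j) y)"
    by (simp only: Suc funpow_Suc_right o_apply)
  finally show ?case .
qed simp

section \<open>Cesaro asymptotic limits\<close>

lemma cinner_cesaro_mean:
  assumes "bounded_clinear T"
  shows "cinner (cesaro_mean T n x) x = of_real ((\<Sum>j=1..n. (norm ((T ^^ j) x))\<^sup>2) / real n)"
proof -
  have "cinner ((cadjoint T ^^ j) ((T ^^ j) x)) x = of_real ((norm ((T ^^ j) x))\<^sup>2)" for j
    by (metis assms cinner_commute cinner_funpow_cadjoint cinner_self complex_cnj_complex_of_real)
  then show ?thesis
    by (simp add: cesaro_mean_def cinner_scaleR_left cinner_sum_left del: of_real_power)
qed

lemma limitin_weak_operator_topologyD:
  assumes "limitin weak_operator_topology F A G"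
  shows "bounded_clinear A" and "((\<lambda>n. cinner (F n x) y) \<longlongrightarrow> cinner (A x) y) G"
proof -
  show A: "bounded_clinear A"
    using limitin_topspace[OF assms] by simp
  show "((\<lambda>n. cinner (F n x) y) \<longlongrightarrow> cinner (A x) y) G"
  proof (rule topological_tendstoI)
    fix U :: "complex set"
    assume U: "open U" "cinner (A x) y \<in> U"
    let ?V = "{S. bounded_clinear S \<and> cinner (S x) y \<in> U}"
    \<comment> \<open>\<open>?V\<close> is one of the generating sets of the topology.\<close>
    have "openin weak_operator_topology ?V"
      unfolding weak_operator_topology_def
      using U by (intro topology_generated_by_Basis) blast
    then have "\<forall>\<^sub>F n in G. F n \<in> ?V"
      using assms A U unfolding limitin_def by blast
    then show "\<forall>\<^sub>F n in G. cinner (F n x) y \<in> U"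
      by (rule eventually_mono) simp
  qed
qed

lemma cesaro_limit_shift:
  fixes a :: "nat \<Rightarrow> real"
  assumes "(\<lambda>n. (\<Sum>j=1..n. a j) / real n) \<longlonglongrightarrow> l"
  shows "(\<lambda>n. (\<Sum>j=1..n. a (Suc j)) / real n) \<longlonglongrightarrow> l"
proof -
  \<comment> \<open>The shifted sum is the sum up to \<open>Suc n\<close> without
    \<open>a 1\<close>. The factor \<open>1 + 1 / real n\<close> replaces the divisor
    \<open>Suc n\<close> by \<open>n\<close> once \<open>n > 0\<close>, and the dropped term
    vanishes in the limit.\<close>
  have "(\<lambda>n. (1 + 1 / real n) * ((\<Sum>j=1..Suc n. a j) / real (Suc n)) - a 1 * (1 / real n))
      \<longlonglongrightarrow> (1 + 0) * l - a 1 * 0"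
    by (intro tendsto_intros lim_1_over_n LIMSEQ_Suc[OF assms])
  moreover have "\<forall>\<^sub>F n in sequentially.
      (1 + 1 / real n) * ((\<Sum>j=1..Suc n. a j) / real (Suc n)) - a 1 * (1 / real n)
      = (\<Sum>j=1..n. a (Suc j)) / real n"
    using eventually_gt_at_top[of 0]
  proof eventually_elim
    case (elim n)
    have "(\<Sum>j=1..Suc n. a j) = a 1 + (\<Sum>j=1..n. a (Suc j))"
      by (simp add: sum.atLeast_Suc_atMost sum.shift_bounds_cl_Suc_ivl del: sum.cl_ivl_Suc)
    moreover have "(1 + 1 / real n) * (s / real (Suc n)) = s / real n" for s
      using elim by (simp add: divide_simps)
    ultimately show ?case
      by (simp only:) (simp add: add_divide_distrib)
  qed
  ultimately show ?thesis
    by (simp add: tendsto_cong)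
qed

theorem theorem5:
  fixes T A :: "'a::chilbert_space \<Rightarrow> 'a"
  assumes "bounded_clinear T"
    and "is_cesaro_asymptotic_limit T A"
    and "A \<noteq> (\<lambda>x. 0)"
  shows "onorm A \<ge> 1"
proof -
  note lim = limitin_weak_operator_topologyD[OF assms(2)[unfolded is_cesaro_asymptotic_limit_def]]
  define L where "L x = Re (cinner (A x) x)" for x
  define M where "M x n = (\<Sum>j=1..n. (norm ((T ^^ j) x))\<^sup>2) / real n" for x n
  have lim_M: "(\<lambda>n. complex_of_real (M x n)) \<longlonglongrightarrow> cinner (A x) x" for x
    using lim(2)[of x x] by (simp only: cinner_cesaro_mean[OF assms(1)] M_def)
  have M: "M x \<longlonglongrightarrow> L x" for x
    using tendsto_Re[OF lim_M[of x]] by (simp add: L_def)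
  \<comment> \<open>As a limit of real numbers, \<open>cinner (A x) x\<close> is real, so
    \<open>L x = 0\<close> makes the whole complex value zero, as polarization requires.\<close>
  have AL: "cinner (A x) x = of_real (L x)" for x
    using lim_M tendsto_of_real[OF M] by (rule LIMSEQ_unique)
  obtain x where "L x \<noteq> 0"
    using bounded_clinear_eq_zeroI[OF lim(1)] AL assms(3) by force
  moreover have "0 \<le> L x"
    by (rule LIMSEQ_le_const[OF M]) (auto simp: M_def intro!: exI[of _ 0] divide_nonneg_nonneg sum_nonneg)
  ultimately have pos: "0 < L x"
    by simp
  have "L (T y) = L y" for y
  proof (rule LIMSEQ_unique[OF M])
    have "M (T y) n = (\<Sum>j=1..n. (norm ((T ^^ Suc j) y))\<^sup>2) / real n" for n
      by (simp add: M_def funpow_swap1)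
    then show "M (T y) \<longlonglongrightarrow> L y"
      using cesaro_limit_shift[OF M[of y, unfolded M_def]] by presburger
  qed
  then have L_funpow: "L ((T ^^ j) x) = L x" for j
    by (induction j) auto
  have L_le: "L y \<le> onorm A * (norm y)\<^sup>2" for y
  proof -
    have "L y \<le> norm (A y) * norm y"
      unfolding L_def by (rule Re_cinner_le)
    also have "\<dots> \<le> onorm A * norm y * norm y"
      using lim(1) by (intro mult_right_mono onorm) (simp_all add: bounded_clinear_def)
    finally show ?thesis
      by (simp add: power2_eq_square mult.assoc)
  qed
  \<comment> \<open>\<open>L\<close> is constant along the orbit of \<open>x\<close>, so the bounds
    \<open>L_le\<close> at the points of the orbit can be averaged. The index \<open>0\<close> is
    excluded because \<open>M x 0 = 0\<close> cannot dominate the positive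
    \<open>L x\<close>.\<close>
  have "L x \<le> onorm A * M x n" if "n \<ge> 1" for n
  proof -
    have "real n * L x = (\<Sum>j=1..n. L x)"
      by simp
    also have "\<dots> \<le> (\<Sum>j=1..n. onorm A * (norm ((T ^^ j) x))\<^sup>2)"
      using L_le L_funpow by (intro sum_mono) metis
    finally show ?thesis
      using that by (simp add: M_def sum_distrib_left field_simps)
  qed
  then have "L x \<le> onorm A * L x"
    by (intro LIMSEQ_le_const[OF tendsto_mult_left[OF M]]) blast
  then show ?thesis
    using pos by simp
qed

end
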